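(* There exists a lattice $L$ with a metric $d$ such that (a) $d(x,\,x\vee y)\le d(x,y)$ for all $x,y\in L$; (b) every increasing Cauchy sequence $x_0\le x_1\le\cdots$ in $L$ converges, and every decreasing Cauchy sequence $x_0\ge x_1\ge\cdots$ in $L$ converges; (c) the operations $\vee$ and $\wedge$ of $L$ are continuous in the metric topology; but $L$ is not complete as a metric space. Dually, there exists a lattice $L$ with a metric $d$ satisfying $d(x,\,x\wedge y)\le d(x,y)$ for all $x,y\in L$, together with (b) and (c), which is not complete as a metric space.
   Context: Cauchyness, convergence and completeness are with respect to the metric $d$. No relation between the metric and the order is assumed other than those stated. *)

theory Defs
  imports "HOL-Analysis.Analysis" "HOL-Algebra.Lattice"
begin

(* HOL cannot quantify existentially over types, so "there exists a lattice with a metric" ranges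
   over carriers that are subsets of the type nat set (of continuum size). This loses nothing: in
   any example, close a non-convergent Cauchy sequence under both operations and under limits of
   monotone Cauchy sequences; the result is an example of at most continuum size. *)

definition metric_lattice :: "('a, 'm) gorder_scheme \<Rightarrow> ('a \<Rightarrow> 'a \<Rightarrow> real) \<Rightarrow> bool"
  where "metric_lattice L d \<longleftrightarrow> lattice L \<and> Metric_space (carrier L) d"

definition monotone_Cauchy_convergent ::
    "('a, 'm) gorder_scheme \<Rightarrow> ('a \<Rightarrow> 'a \<Rightarrow> real) \<Rightarrow> bool"
  where "monotone_Cauchy_convergent L d \<longleftrightarrow>
    (\<forall>x::nat \<Rightarrow> 'a.
       Metric_space.MCauchy (carrier L) d x \<and>
       ((\<forall>n. x n \<sqsubseteq>\<^bsub>L\<^esub> x (Suc n)) \<or> (\<forall>n. x (Suc n) \<sqsubseteq>\<^bsub>L\<^esub> x n)) \<longrightarrow>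
       (\<exists>l. limitin (Metric_space.mtopology (carrier L) d) x l sequentially))"

definition continuous_lattice_operations ::
    "('a, 'm) gorder_scheme \<Rightarrow> ('a \<Rightarrow> 'a \<Rightarrow> real) \<Rightarrow> bool"
  where "continuous_lattice_operations L d \<longleftrightarrow>
    (let T = Metric_space.mtopology (carrier L) d in
       continuous_map (prod_topology T T) T (\<lambda>(x, y). x \<squnion>\<^bsub>L\<^esub> y) \<and>
       continuous_map (prod_topology T T) T (\<lambda>(x, y). x \<sqinter>\<^bsub>L\<^esub> y))"

end

(* In the lattice of finite sets of naturals let f A = 1 / (1 + Min A), with f {} = 1, and let
   distinct A, B have distance max (f A) (f B). Distances from A are bounded below by f A > 0, so
   the topology is discrete; (a) holds since f (A \<union> B) \<le> max (f A) (f B). Along an increasing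
   sequence f is bounded away from 0, and a decreasing sequence of finite sets stabilises, so
   monotone Cauchy sequences are eventually constant. But f {n} tends to 0, so the singletons {n}
   form a Cauchy sequence without limit. The second claim follows by reversing the order. *)

theory Submission
  imports Defs
begin

section \<open>Metrics induced by a positive weight\<close>

definition max_dist :: "('a \<Rightarrow> real) \<Rightarrow> 'a \<Rightarrow> 'a \<Rightarrow> real"
  where "max_dist f x y = (if x = y then 0 else max (f x) (f y))"

text \<open>For distinct points the triangle inequality follows from \<open>max (f x) (f z)\<close>
  being at most the larger of \<open>max (f x) (f y)\<close> and \<open>max (f y) (f z)\<close>;
  \<open>max_dist f\<close> is in fact an ultrametric.\<close>

lemma Metric_space_max_dist:
  assumes pos: "\<And>x. f x > 0"
  shows "Metric_space M (max_dist f)"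
proof
  fix x y z
  have nonneg: "0 \<le> f u" for u
    using pos[of u] by simp
  show "0 \<le> max_dist f x y"
    using nonneg[of x] by (auto simp: max_dist_def le_max_iff_disj)
  show "max_dist f x y = max_dist f y x"
    by (simp add: max_dist_def max.commute)
  show "max_dist f x y = 0 \<longleftrightarrow> x = y"
    using pos[of x] by (auto simp: max_dist_def max_def)
  show "max_dist f x z \<le> max_dist f x y + max_dist f y z"
    using nonneg[of x] nonneg[of y] nonneg[of z] by (auto simp: max_dist_def)
qed

lemma mtopology_max_dist:
  assumes pos: "\<And>x. f x > 0"
  shows "Metric_space.mtopology M (max_dist f) = discrete_topology M"
proof -
  interpret Metric_space M "max_dist f"
    by (rule Metric_space_max_dist) (rule pos)
  \<comment> \<open>Every other point is at distance at least \<open>f x\<close> from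
    \<open>x\<close>, so this radius isolates \<open>x\<close>.\<close>
  have "mball x (f x) = {x}" if "x \<in> M" for x
    using that pos[of x] by (auto simp: max_dist_def split: if_splits)
  then have "openin mtopology {x}" if "x \<in> M" for x
    using that openin_mball by metis
  then show ?thesis
    by (metis discrete_topology_unique topspace_mtopology)
qed

lemma limitin_discrete_topology_iff:
  "limitin (discrete_topology M) x l F \<longleftrightarrow> l \<in> M \<and> (\<forall>\<^sub>F n in F. x n = l)"
proof
  assume lim: "limitin (discrete_topology M) x l F"
  then have "l \<in> M"
    using limitin_topspace by fastforce
  moreover have "\<forall>\<^sub>F n in F. x n \<in> {l}"
    using lim \<open>l \<in> M\<close> unfolding limitin_def by (metis empty_subsetI insert_subset openin_discrete_topology singletonI)
  ultimately show "l \<in> M \<and> (\<forall>\<^sub>F n in F. x n = l)"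
    by simp
next
  assume "l \<in> M \<and> (\<forall>\<^sub>F n in F. x n = l)"
  then show "limitin (discrete_topology M) x l F"
    by (auto simp: limitin_def elim: eventually_mono)
qed

text \<open>Distinct terms with index at least \<open>N\<close> are at distance at least
  \<open>e\<close>, so the Cauchy condition at scale \<open>e\<close> forces the tail to be
  constant.\<close>

lemma MCauchy_max_dist_eventually_const:
  assumes pos: "\<And>x. f x > 0"
    and Cauchy: "Metric_space.MCauchy M (max_dist f) x"
    and "e > 0" and low: "\<And>n. n \<ge> N \<Longrightarrow> e \<le> f (x n)"
  shows "\<exists>l\<in>M. \<forall>\<^sub>F n in sequentially. x n = l"
proof -
  interpret Metric_space M "max_dist f"
    by (rule Metric_space_max_dist) (rule pos)
  obtain N' where N': "\<And>m n. m \<ge> N' \<Longrightarrow> n \<ge> N' \<Longrightarrow> max_dist f (x m) (x n) < e"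
    using Cauchy \<open>e > 0\<close> unfolding MCauchy_def by blast
  define K where "K = max N N'"
  have "x n = x K" if "n \<ge> K" for n
    using N'[of n K] low[of n] that
    by (auto simp: K_def max_dist_def split: if_splits)
  then have "\<forall>\<^sub>F n in sequentially. x n = x K"
    unfolding eventually_sequentially by blast
  moreover have "x K \<in> M"
    using Cauchy by (auto simp: MCauchy_def)
  ultimately show ?thesis
    by (rule bexI[of _ "x K"])
qed

section \<open>The lattice of finite sets\<close>

definition finset_lattice :: "'a set gorder"
  where "finset_lattice = \<lparr>carrier = Collect finite, eq = (=), le = (\<subseteq>)\<rparr>"

lemma finset_lattice_simps [simp]:
  "carrier finset_lattice = Collect finite"
  "A .=\<^bsub>finset_lattice\<^esub> B \<longleftrightarrow> A = B"
  "A \<sqsubseteq>\<^bsub>finset_lattice\<^esub> B \<longleftrightarrow> A \<subseteq> B"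
  by (simp_all add: finset_lattice_def)

lemma least_Upper_finset_lattice:
  "finite A \<Longrightarrow> finite B \<Longrightarrow> least finset_lattice (A \<union> B) (Upper finset_lattice {A, B})"
  by (auto simp: least_def Upper_def)

lemma greatest_Lower_finset_lattice:
  "finite A \<Longrightarrow> finite B \<Longrightarrow> greatest finset_lattice (A \<inter> B) (Lower finset_lattice {A, B})"
  by (auto simp: greatest_def Lower_def)

lemma lattice_finset_lattice: "lattice finset_lattice"
proof unfold_locales
  show "(.=\<^bsub>finset_lattice\<^esub>) = (=)"
    by (simp add: finset_lattice_def)
  show "\<exists>s. least finset_lattice s (Upper finset_lattice {A, B})"
    if "A \<in> carrier finset_lattice" "B \<in> carrier finset_lattice" for A B
    using that least_Upper_finset_lattice by auto
  show "\<exists>s. greatest finset_lattice s (Lower finset_lattice {A, B})"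
    if "A \<in> carrier finset_lattice" "B \<in> carrier finset_lattice" for A B
    using that greatest_Lower_finset_lattice by auto
qed auto

lemma join_finset_lattice:
  assumes "finite A" "finite B"
  shows "A \<squnion>\<^bsub>finset_lattice\<^esub> B = A \<union> B"
proof -
  interpret lattice "finset_lattice :: 'a set gorder"
    by (rule lattice_finset_lattice)
  show ?thesis
  proof (rule joinI[where P = "\<lambda>s. s = A \<union> B"])
    show "s = A \<union> B" if "least finset_lattice s (Upper finset_lattice {A, B})" for s
      using that least_Upper_finset_lattice[OF assms] by (rule least_unique)
  qed (use assms in auto)
qed

text \<open>The empty set is a point of the lattice, being the meet of disjoint sets; the positive
  value 1 keeps it isolated. \<open>Suc\<close> keeps the denominator positive when the least
  element is 0.\<close>

definition min_weight :: "nat set \<Rightarrow> real"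
  where "min_weight A = (if A = {} then 1 else 1 / real (Suc (Min A)))"

lemma min_weight_pos: "min_weight A > 0"
  by (simp add: min_weight_def)

lemma min_weight_ge: "finite A \<Longrightarrow> k \<in> A \<Longrightarrow> 1 / real (Suc k) \<le> min_weight A"
  by (auto simp: min_weight_def intro!: divide_left_mono)

text \<open>The least element of a union is one of the two least elements, so the weight of the
  union is one of the two weights.\<close>

lemma min_weight_Un:
  assumes "finite A" "finite B"
  shows "min_weight (A \<union> B) \<le> max (min_weight A) (min_weight B)"
proof (cases "A = {} \<or> B = {}")
  case True
  then show ?thesis by auto
next
  case False
  then have "Min (A \<union> B) = Min A \<or> Min (A \<union> B) = Min B"
    using assms by (auto simp: Min_Un min_def)
  with False show ?thesis by (auto simp: min_weight_def)
qed

abbreviation finset_dist :: "nat set \<Rightarrow> nat set \<Rightarrow> real"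
  where "finset_dist \<equiv> max_dist min_weight"

text \<open>If B is contained in A, the left side is 0. Otherwise it is the maximum of the weights
  of A and of the union, and \<open>min_weight_Un\<close> bounds the latter.\<close>

lemma finset_dist_join_le:
  assumes "finite A" "finite B"
  shows "finset_dist A (A \<squnion>\<^bsub>finset_lattice\<^esub> B) \<le> finset_dist A B"
  using min_weight_Un[OF assms] min_weight_pos[of A] join_finset_lattice[OF assms]
  by (auto simp: max_dist_def)

section \<open>Monotone sequences of finite sets\<close>

lemma decseq_finite_eventually_const:
  fixes x :: "nat \<Rightarrow> 'a set"
  assumes fin: "\<And>n. finite (x n)" and dec: "decseq x"
  shows "\<exists>N. \<forall>n\<ge>N. x n = x N"
proof -
  \<comment> \<open>\<open>x N\<close> has least cardinality among all terms, so no later term can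
    be a proper subset of it.\<close>
  obtain N where N: "\<And>n. card (x N) \<le> card (x n)"
    using ex_has_least_nat[of "\<lambda>_. True" _ "\<lambda>n. card (x n)"] by auto
  have "x n = x N" if "n \<ge> N" for n
    using card_seteq[OF fin[of N] decseqD[OF dec that] N] .
  then show ?thesis by blast
qed

text \<open>Once some \<open>k\<close> enters the sequence it stays, so the least element never
  exceeds \<open>k\<close> again. The sequence that is always empty has constant weight 1.\<close>

lemma incseq_min_weight_bounded_below:
  assumes fin: "\<And>n. finite (x n)" and inc: "incseq x"
  shows "\<exists>e>0. \<exists>N. \<forall>n\<ge>N. e \<le> min_weight (x n)"
proof (cases "\<forall>n. x n = {}")
  case True
  then show ?thesis
    by (intro exI[of _ 1]) (simp add: min_weight_def)
next
  case False
  then obtain N k where k: "k \<in> x N" by blast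
  have "1 / real (Suc k) \<le> min_weight (x n)" if "n \<ge> N" for n
    using min_weight_ge[OF fin] incseqD[OF inc that] k by blast
  then show ?thesis
    by (intro exI[of _ "1 / real (Suc k)"]) auto
qed

lemma monotone_Cauchy_convergent_finset_lattice:
  "monotone_Cauchy_convergent finset_lattice finset_dist"
proof -
  interpret Metric_space "Collect finite" finset_dist
    by (rule Metric_space_max_dist) (rule min_weight_pos)
  \<comment> \<open>The topology is discrete, so convergence means being eventually
    constant.\<close>
  have "\<exists>l. finite l \<and> (\<forall>\<^sub>F n in sequentially. x n = l)"
    if Cauchy: "MCauchy x" and mono: "(\<forall>n. x n \<subseteq> x (Suc n)) \<or> (\<forall>n. x (Suc n) \<subseteq> x n)" for x
  proof -
    have fin: "finite (x n)" for n
      using Cauchy by (auto simp: MCauchy_def)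
    show ?thesis using mono
    proof
      assume "\<forall>n. x n \<subseteq> x (Suc n)"
      then have "incseq x" by (simp add: incseq_Suc_iff)
      then obtain e N where "e > 0" "\<And>n. n \<ge> N \<Longrightarrow> e \<le> min_weight (x n)"
        using incseq_min_weight_bounded_below[of x] fin by blast
      with MCauchy_max_dist_eventually_const[OF min_weight_pos Cauchy] show ?thesis
        by blast
    next
      assume "\<forall>n. x (Suc n) \<subseteq> x n"
      then have "decseq x" by (simp add: decseq_Suc_iff)
      then obtain N where "\<forall>n\<ge>N. x n = x N"
        using decseq_finite_eventually_const[of x] fin by blast
      then have "\<forall>\<^sub>F n in sequentially. x n = x N"
        unfolding eventually_sequentially by blast
      with fin[of N] show ?thesis by blast
    qed
  qed
  then show ?thesis
    by (simp add: monotone_Cauchy_convergent_def mtopology_max_dist[OF min_weight_pos]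
        limitin_discrete_topology_iff)
qed

text \<open>A product of two discrete topologies is discrete, so continuity only asks that the
  carrier be closed under both operations.\<close>

lemma continuous_lattice_operations_discrete:
  assumes "lattice L" and "Metric_space.mtopology (carrier L) d = discrete_topology (carrier L)"
  shows "continuous_lattice_operations L d"
proof -
  interpret lattice L by fact
  show ?thesis
    by (auto simp: continuous_lattice_operations_def Let_def assms(2)
        simp flip: prod_topology_discrete_topology)
qed

lemma not_mcomplete_finset_dist: "\<not> Metric_space.mcomplete (Collect finite) finset_dist"
proof
  interpret Metric_space "Collect finite" finset_dist
    by (rule Metric_space_max_dist) (rule min_weight_pos)
  assume complete: mcomplete
  have "MCauchy (\<lambda>n. {n})"
    unfolding MCauchy_def
  proof (intro conjI allI impI)
    show "range (\<lambda>n. {n}) \<subseteq> Collect finite" by auto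
    fix e :: real assume "e > 0"
    then obtain N where N: "1 / real (Suc N) < e"
      using nat_approx_posE by blast
    have weight: "min_weight {n} < e" if "n \<ge> N" for n
    proof -
      have "min_weight {n} \<le> 1 / real (Suc N)"
        using that by (auto simp: min_weight_def intro!: divide_left_mono)
      with N show ?thesis by simp
    qed
    show "\<exists>N. \<forall>m n. N \<le> m \<longrightarrow> N \<le> n \<longrightarrow> finset_dist {m} {n} < e"
      using weight \<open>e > 0\<close> by (intro exI[of _ N]) (auto simp: max_dist_def)
  qed
  with complete obtain l where "limitin mtopology (\<lambda>n. {n}) l sequentially"
    unfolding mcomplete_def by blast
  \<comment> \<open>A limit in the discrete topology would equal all late terms, yet consecutive
    singletons differ.\<close>
  then have "\<forall>\<^sub>F n in sequentially. {n} = l"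
    by (simp add: mtopology_max_dist[OF min_weight_pos] limitin_discrete_topology_iff)
  then obtain N where "\<And>n. n \<ge> N \<Longrightarrow> {n} = l"
    by (auto simp: eventually_sequentially)
  from this[of N] this[of "Suc N"] show False by auto
qed

section \<open>Reversal of the order\<close>

lemma lattice_inv_gorder:
  assumes "lattice L"
  shows "lattice (inv_gorder L)"
proof -
  interpret lattice L by fact
  \<comment> \<open>The weak lattice supplies the binary bounds, the partial order that equivalence
    is equality.\<close>
  interpret dual: weak_lattice "inv_gorder L" by (rule dual_weak_lattice)
  interpret dual: partial_order "inv_gorder L" by (rule dual_order)
  show ?thesis
    by unfold_locales (rule dual.sup_of_two_exists dual.inf_of_two_exists; assumption)+
qed

lemma metric_lattice_inv_gorder:
  "metric_lattice L d \<Longrightarrow> metric_lattice (inv_gorder L) d"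
  by (simp add: metric_lattice_def lattice_inv_gorder)

text \<open>Reversal swaps increasing and decreasing sequences, and the condition treats both
  alike.\<close>

lemma monotone_Cauchy_convergent_inv_gorder:
  "monotone_Cauchy_convergent (inv_gorder L) d \<longleftrightarrow> monotone_Cauchy_convergent L d"
  by (auto simp: monotone_Cauchy_convergent_def)

lemma continuous_lattice_operations_inv_gorder:
  "continuous_lattice_operations (inv_gorder L) d \<longleftrightarrow> continuous_lattice_operations L d"
  by (auto simp: continuous_lattice_operations_def Let_def)

theorem mainTheorem5:
  "(\<exists>(L :: nat set gorder) d.
      metric_lattice L d \<and>
      (\<forall>x\<in>carrier L. \<forall>y\<in>carrier L. d x (x \<squnion>\<^bsub>L\<^esub> y) \<le> d x y) \<and>
      monotone_Cauchy_convergent L d \<and>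
      continuous_lattice_operations L d \<and>
      \<not> Metric_space.mcomplete (carrier L) d) \<and>
   (\<exists>(L :: nat set gorder) d.
      metric_lattice L d \<and>
      (\<forall>x\<in>carrier L. \<forall>y\<in>carrier L. d x (x \<sqinter>\<^bsub>L\<^esub> y) \<le> d x y) \<and>
      monotone_Cauchy_convergent L d \<and>
      continuous_lattice_operations L d \<and>
      \<not> Metric_space.mcomplete (carrier L) d)"
  (is "?join_version \<and> ?meet_version")
proof
  have "Metric_space (Collect finite) finset_dist"
    by (rule Metric_space_max_dist) (rule min_weight_pos)
  moreover have "continuous_lattice_operations finset_lattice finset_dist"
    by (intro continuous_lattice_operations_discrete lattice_finset_lattice
        mtopology_max_dist min_weight_pos)
  ultimately show ?join_version
    by (intro exI[of _ finset_lattice] exI[of _ finset_dist])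
      (simp add: metric_lattice_def lattice_finset_lattice finset_dist_join_le
        monotone_Cauchy_convergent_finset_lattice not_mcomplete_finset_dist)
  \<comment> \<open>Any witness of the join version serves: reversing its order turns joins into
    meets and leaves the metric unchanged.\<close>
  then obtain L :: "nat set gorder" and d where
    "metric_lattice L d"
    "\<forall>x\<in>carrier L. \<forall>y\<in>carrier L. d x (x \<squnion>\<^bsub>L\<^esub> y) \<le> d x y"
    "monotone_Cauchy_convergent L d"
    "continuous_lattice_operations L d"
    "\<not> Metric_space.mcomplete (carrier L) d"
    by blast
  then show ?meet_version
    by (intro exI[of _ "inv_gorder L"] exI[of _ d])
      (simp add: metric_lattice_inv_gorder monotone_Cauchy_convergent_inv_gorder
        continuous_lattice_operations_inv_gorder)
qed

end
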